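(* Let $k\in\mathbb{Z}$, let $n\ge 0$ be an integer, let $x\in\mathbb{R}$, and let $a,b,c$ be positive real numbers with $a\neq b$, $b>a$ and $ab\neq 1$. Then: (i) $B_n^{(k)}(a,b)=(\ln a+\ln b)^n\,B_n^{(k)}\!\left(\dfrac{-\ln b}{\ln a+\ln b}\right)$; (ii) $B_n^{(k)}(a,b)=\displaystyle\sum_{i=0}^{n}(-1)^{n-i}\binom{n}{i}(\ln a+\ln b)^i(\ln b)^{n-i}B_i^{(k)}$; (iii) $B_n^{(k)}(x;a,b,c)=\displaystyle\sum_{l=0}^{n}\binom{n}{l}(\ln c)^{n-l}B_l^{(k)}(a,b)\,x^{n-l}$; (iv) $B_n^{(k)}(x+1;a,b,c)=B_n^{(k)}\!\left(x;\,ac,\,\tfrac{b}{c},\,c\right)$; (v) for every real $t$, $B_n^{(k)}(t)=B_n^{(k)}(e^{t+1},e^{-t})$; (vi) $B_n^{(k)}(x;a,b,c)=(\ln a+\ln b)^n\,B_n^{(k)}\!\left(\dfrac{-\ln b+x\ln c}{\ln a+\ln b}\right)$.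
   Context: For $k\in\mathbb{Z}$ and $|z|<1$ let $\mathrm{Li}_k(z)=\sum_{m\ge1} z^m/m^k$ (for $k\le 0$ this is a rational function, e.g. $\mathrm{Li}_0(z)=z/(1-z)$). The poly-Bernoulli numbers $B_n^{(k)}$ are defined by $\frac{\mathrm{Li}_k(1-e^{-x})}{1-e^{-x}}=\sum_{n\ge0}B_n^{(k)}\frac{x^n}{n!}$, and the poly-Bernoulli polynomials $B_n^{(k)}(t)$ by $\frac{\mathrm{Li}_k(1-e^{-x})}{1-e^{-x}}e^{xt}=\sum_{n\ge0}B_n^{(k)}(t)\frac{x^n}{n!}$. For positive reals $a,b$ with $ab\ne1$ (the paper states its definition with the assumption $a\neq b$) and $c>0$, the generalized poly-Bernoulli numbers $B_n^{(k)}(a,b)$ and polynomials $B_n^{(k)}(x;a,b,c)$ (also written $B_n^{(k)}(x,a,b,c)$) are defined by the power series expansions in $t$ (valid for $|t|<2\pi/|\ln a+\ln b|$) $\frac{\mathrm{Li}_k(1-(ab)^{-t})}{b^t-a^{-t}}=\sum_{n\ge0}B_n^{(k)}(a,b)\frac{t^n}{n!}$ and $\frac{\mathrm{Li}_k(1-(ab)^{-t})}{b^t-a^{-t}}c^{xt}=\sum_{n\ge0}B_n^{(k)}(x;a,b,c)\frac{t^n}{n!}$. *)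

theory Defs
  imports "HOL-Complex_Analysis.Complex_Analysis"
begin

text \<open>The defining series of \<open>Li\<^sub>k\<close>, shifted to start at \<open>m = 0\<close>; meaningful for \<^term>\<open>norm z < 1\<close>.\<close>

definition polylog :: "int \<Rightarrow> 'a::{real_normed_field,banach} \<Rightarrow> 'a" where
  "polylog k z = (\<Sum>m. z ^ Suc m / of_nat (Suc m) powi k)"

text \<open>The neighbourhood is punctured because the generating functions below are quotients whose
  value at \<open>0\<close> is to be read as the limit, whereas HOL has \<open>0 / 0 = 0\<close>.\<close>

definition has_egf :: "(real \<Rightarrow> real) \<Rightarrow> (nat \<Rightarrow> real) \<Rightarrow> bool" where
  "has_egf f B \<longleftrightarrow> (\<forall>\<^sub>F t in at 0. (\<lambda>n. B n * (t ^ n / fact n)) sums f t)"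

definition egf_coeff :: "(real \<Rightarrow> real) \<Rightarrow> nat \<Rightarrow> real" where
  "egf_coeff f = (THE B. has_egf f B)"

definition poly_bernoulli :: "int \<Rightarrow> nat \<Rightarrow> real" where
  "poly_bernoulli k = egf_coeff (\<lambda>x. polylog k (1 - exp (- x)) / (1 - exp (- x)))"

definition poly_bernoulli_poly :: "int \<Rightarrow> nat \<Rightarrow> real \<Rightarrow> real" where
  "poly_bernoulli_poly k n t =
     egf_coeff (\<lambda>x. polylog k (1 - exp (- x)) / (1 - exp (- x)) * exp (x * t)) n"

definition gen_poly_bernoulli :: "int \<Rightarrow> nat \<Rightarrow> real \<Rightarrow> real \<Rightarrow> real" where
  "gen_poly_bernoulli k n a b =
     egf_coeff (\<lambda>t. polylog k (1 - (a * b) powr (- t)) / (b powr t - a powr (- t))) n"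

definition gen_poly_bernoulli_poly ::
  "int \<Rightarrow> nat \<Rightarrow> real \<Rightarrow> real \<Rightarrow> real \<Rightarrow> real \<Rightarrow> real" where
  "gen_poly_bernoulli_poly k n x a b c =
     egf_coeff (\<lambda>t. polylog k (1 - (a * b) powr (- t)) / (b powr t - a powr (- t))
                     * c powr (x * t)) n"

lemma has_egf_unique:
  assumes "has_egf f B" "has_egf f C"
  shows "B = C"
proof -
  have ev: "\<forall>\<^sub>F t in at 0. (\<lambda>n. (B n - C n) / fact n * t ^ n) sums (0::real)"
    using assms unfolding has_egf_def
  proof eventually_elim
    case (elim t)
    from sums_diff[OF this] show ?case by (simp add: field_simps)
  qed
  then obtain d where d: "d > 0"
    "\<And>t. t \<noteq> 0 \<Longrightarrow> norm t < d \<Longrightarrow> (\<lambda>n. (B n - C n) / fact n * t ^ n) sums (0::real)"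
    unfolding eventually_at by auto
  have "(B m - C m) / fact m = 0" for m
  proof (induction m rule: less_induct)
    case (less m)
    have "(\<lambda>n. (B (n + m) - C (n + m)) / fact (n + m) * t ^ n) sums (0::real)"
      if t: "t \<noteq> 0" "norm t < d" for t
    proof -
      have "(\<lambda>n. (B (n + m) - C (n + m)) / fact (n + m) * t ^ (n + m)) sums
              (0 - (\<Sum>i<m. (B i - C i) / fact i * t ^ i))"
        using d(2)[OF t] by (subst sums_iff_shift) simp
      also have "(\<Sum>i<m. (B i - C i) / fact i * t ^ i) = 0"
        using less.IH by simp
      finally have "(\<lambda>n. (B (n + m) - C (n + m)) / fact (n + m) * t ^ (n + m) / t ^ m) sums (0 / t ^ m)"
        by (intro sums_divide) simp
      thus ?thesis using t by (simp add: power_add)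
    qed
    from powser_limit_0_strong[of d "\<lambda>n. (B (n + m) - C (n + m)) / fact (n + m)" "\<lambda>_. 0", OF d(1) this]
    have "((\<lambda>_. 0) \<longlongrightarrow> (B m - C m) / fact m) (at (0::real))" by simp
    thus ?case using tendsto_unique[OF at_neq_bot _ tendsto_const] by blast
  qed
  thus ?thesis by auto
qed

lemma egf_coeff_eqI: "has_egf f B \<Longrightarrow> egf_coeff f = B"
  unfolding egf_coeff_def using has_egf_unique by blast

lemma has_egf_egf_coeff: "has_egf f B \<Longrightarrow> has_egf f (egf_coeff f)"
  using egf_coeff_eqI by simp

lemma polylog_base_conv_radius:
  "conv_radius (\<lambda>m. 1 / of_nat (Suc m) powi k :: complex) = 1"
proof (rule conv_radius_ratio_limit_nonzero[where c = 1])
  have *: "(\<lambda>m. (real (Suc (Suc m)) / real (Suc m)) powi k) \<longlonglongrightarrow> 1 powi k"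
    by (intro tendsto_power_int LIMSEQ_Suc_n_over_n) (use LIMSEQ_Suc[OF LIMSEQ_Suc_n_over_n] in auto)
  have "(real (Suc (Suc m)) / real (Suc m)) powi k =
      norm (1 / of_nat (Suc m) powi k :: complex) / norm (1 / of_nat (Suc (Suc m)) powi k :: complex)" for m
    by (simp add: norm_divide norm_power_int power_int_divide_distrib del: of_nat_Suc)
  with * show "(\<lambda>m. norm (1 / of_nat (Suc m) powi k :: complex) /
      norm (1 / of_nat (Suc (Suc m)) powi k :: complex)) \<longlonglongrightarrow> 1"
    by simp
qed (auto simp: one_ereal_def)

lemma has_egf_polylog_base:
  fixes L s :: real
  assumes "L \<noteq> 0"
  shows "\<exists>B. has_egf (\<lambda>t. polylog k (1 - exp (- (L * t))) / (1 - exp (- (L * t))) * exp (s * t)) B"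
proof -
  define P :: "complex fps" where "P = Abs_fps (\<lambda>m. 1 / of_nat (Suc m) powi k)"
  have P: "eval_fps P has_fps_expansion P"
    by (rule eval_fps_has_fps_expansion)
       (simp add: P_def fps_conv_radius_def polylog_base_conv_radius del: of_nat_Suc)
  define h where "h = (\<lambda>z. (eval_fps P \<circ> (\<lambda>z. 1 - exp (- of_real L * z))) z * exp (of_real s * z))"
  define G :: "complex fps" where "G = 1 - fps_exp (- of_real L)"
  have G: "(\<lambda>z. 1 - exp (- of_real L * z)) has_fps_expansion G"
    unfolding G_def by (rule has_fps_expansion_diff[OF has_fps_expansion_1 has_fps_expansion_exp])
  have G0: "fps_nth G 0 = 0" by (simp add: G_def)
  define H where "H = fps_compose P G * fps_exp (of_real s)"
  have H: "h has_fps_expansion H"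
    unfolding h_def H_def
    by (rule has_fps_expansion_mult[OF has_fps_expansion_compose[OF P G G0] has_fps_expansion_exp])
  have "\<forall>\<^sub>F z in nhds 0. z \<in> eball 0 (fps_conv_radius H)"
    using H by (intro eventually_nhds_in_open) (auto simp: has_fps_expansion_def zero_ereal_def)
  moreover have "\<forall>\<^sub>F z in nhds 0. eval_fps H z = h z"
    using H by (auto simp: has_fps_expansion_def)
  ultimately have "\<forall>\<^sub>F z in nhds 0. (\<lambda>n. fps_nth H n * z ^ n) sums h z"
  proof eventually_elim
    case (elim z)
    thus ?case using sums_eval_fps[of z H] by simp
  qed
  moreover have "filterlim (of_real :: real \<Rightarrow> complex) (nhds 0) (at 0)"
    by (rule tendsto_eq_intros refl | simp)+
  ultimately have ev: "\<forall>\<^sub>F t in at 0. (\<lambda>n. fps_nth H n * of_real t ^ n) sums h (of_real t)"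
    by (rule eventually_compose_filterlim)
  have "((\<lambda>t. 1 - exp (- (L * t))) \<longlongrightarrow> 0) (at 0)"
    by (rule tendsto_eq_intros refl | simp)+
  hence small: "\<forall>\<^sub>F t in at 0. norm (1 - exp (- (L * t))) < 1"
    by (intro order_tendstoD(2)[where y = 0] tendsto_norm_zero) auto
  have nz: "\<forall>\<^sub>F t in at 0. t \<noteq> (0::real)"
    by (simp add: eventually_at_filter)
  have "has_egf (\<lambda>t. polylog k (1 - exp (- (L * t))) / (1 - exp (- (L * t))) * exp (s * t))
          (\<lambda>n. Re (fps_nth H n) * fact n)"
    unfolding has_egf_def using ev small nz
  proof eventually_elim
    case (elim t)
    define w where "w = 1 - exp (- (L * t))"
    have w: "norm w < 1" "w \<noteq> 0" using elim assms by (auto simp: w_def)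
    have "norm (complex_of_real w) < fps_conv_radius P"
      using w by (simp add: P_def fps_conv_radius_def polylog_base_conv_radius one_ereal_def
                       del: of_nat_Suc)
    hence "(\<lambda>n. fps_nth P n * of_real w ^ n) sums eval_fps P (of_real w)"
      by (rule sums_eval_fps)
    moreover have "fps_nth P n * of_real w ^ n = of_real (w ^ n / real (Suc n) powi k)" for n
      by (simp add: P_def del: of_nat_Suc)
    ultimately have "(\<lambda>n. complex_of_real (w ^ n / real (Suc n) powi k)) sums eval_fps P (of_real w)"
      by simp
    from sums_Re[OF this] have "(\<lambda>n. w ^ n / real (Suc n) powi k) sums Re (eval_fps P (of_real w))"
      unfolding Re_complex_of_real .
    from sums_mult[OF this, of w] have "(\<lambda>n. w ^ Suc n / real (Suc n) powi k) sums (w * Re (eval_fps P (of_real w)))"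
      by (simp del: of_nat_Suc)
    hence "polylog k w = w * Re (eval_fps P (of_real w))"
      unfolding polylog_def by (rule sums_unique[symmetric])
    moreover have "h (of_real t) = eval_fps P (of_real w) * of_real (exp (s * t))"
      by (simp add: h_def w_def exp_of_real flip: of_real_mult of_real_minus)
    ultimately have "Re (h (of_real t)) = polylog k w / w * exp (s * t)"
      using w by simp
    with sums_Re[OF elim(1)] show ?case
      by (simp add: w_def flip: of_real_power)
  qed
  thus ?thesis by blast
qed

text \<open>The defining expansions hold, so the definite description above always denotes.\<close>

lemma has_egf_poly_bernoulli:
  "has_egf (\<lambda>x. polylog k (1 - exp (- x)) / (1 - exp (- x))) (poly_bernoulli k)"
  unfolding poly_bernoulli_def using has_egf_polylog_base[of 1 k 0] has_egf_egf_coeff by auto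

lemma has_egf_poly_bernoulli_poly:
  "has_egf (\<lambda>x. polylog k (1 - exp (- x)) / (1 - exp (- x)) * exp (x * t))
     (\<lambda>n. poly_bernoulli_poly k n t)"
  unfolding poly_bernoulli_poly_def using has_egf_polylog_base[of 1 k t] has_egf_egf_coeff
  by (auto simp: mult.commute)

lemma has_egf_gen_poly_bernoulli_poly:
  assumes "a > 0" "b > 0" "c > 0" "a * b \<noteq> 1"
  shows "has_egf (\<lambda>t. polylog k (1 - (a * b) powr (- t)) / (b powr t - a powr (- t)) * c powr (x * t))
           (\<lambda>n. gen_poly_bernoulli_poly k n x a b c)"
proof -
  let ?L = "ln a + ln b"
  have L: "?L \<noteq> 0"
    using assms by (simp flip: ln_mult_pos)
  have "polylog k (1 - exp (- (?L * t))) / (1 - exp (- (?L * t))) * exp ((x * ln c - ln b) * t)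
      = polylog k (1 - (a * b) powr (- t)) / (b powr t - a powr (- t)) * c powr (x * t)" for t
  proof -
    have 1: "(a * b) powr (- t) = exp (- (?L * t))"
      using assms by (simp add: powr_def ln_mult algebra_simps)
    have 2: "b powr t - a powr (- t) = (1 - exp (- (?L * t))) * exp (ln b * t)"
      using assms by (simp add: powr_def algebra_simps flip: exp_add)
    have 3: "c powr (x * t) = exp ((x * ln c - ln b) * t) * exp (ln b * t)"
      using assms by (simp add: powr_def algebra_simps flip: exp_add)
    show ?thesis unfolding 1 2 3 by simp
  qed
  with has_egf_polylog_base[OF L, of k "x * ln c - ln b"] show ?thesis
    unfolding gen_poly_bernoulli_poly_def using has_egf_egf_coeff by auto
qed

lemma has_egf_gen_poly_bernoulli:
  assumes "a > 0" "b > 0" "a * b \<noteq> 1"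
  shows "has_egf (\<lambda>t. polylog k (1 - (a * b) powr (- t)) / (b powr t - a powr (- t)))
           (\<lambda>n. gen_poly_bernoulli k n a b)"
  using has_egf_gen_poly_bernoulli_poly[of a b 1 k 0] assms
  by (simp add: gen_poly_bernoulli_poly_def gen_poly_bernoulli_def)

end

theory Submission
  imports Defs
begin

text \<open>Put \<open>L = ln a + ln b\<close> and \<open>F(t) = Li\<^sub>k(1 - e\<^bsup>-t\<^esup>) / (1 - e\<^bsup>-t\<^esup>)\<close>. Since
  \<open>b\<^bsup>t\<^esup> - a\<^bsup>-t\<^esup> = (1 - e\<^bsup>-Lt\<^esup>) e\<^bsup>t ln b\<^esup>\<close>, the generating function of the generalized polynomials
  is \<open>F(Lt) e\<^bsup>(x ln c - ln b) t\<^esup>\<close>. All identities then follow from uniqueness of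
  coefficients and two operations on exponential generating functions: rescaling the argument
  multiplies the \<open>n\<close>-th coefficient by \<open>L\<^sup>n\<close>, and multiplying by \<open>e\<^bsup>st\<^esup>\<close> is a binomial convolution
  with the powers of \<open>s\<close>.\<close>

lemma has_egf_scale:
  assumes "has_egf f B" "L \<noteq> 0"
  shows "has_egf (\<lambda>t. f (L * t)) (\<lambda>n. L ^ n * B n)"
proof -
  \<comment> \<open>\<open>L \<noteq> 0\<close> keeps the rescaled argument off 0, so the punctured
    neighbourhood in \<open>has_egf\<close> is respected.\<close>
  have "filterlim (\<lambda>t. L * t) (at 0) (at 0)"
    using assms(2) by (auto simp: filterlim_at eventually_at_filter intro!: tendsto_eq_intros)
  with assms(1) have "\<forall>\<^sub>F t in at 0. (\<lambda>n. B n * ((L * t) ^ n / fact n)) sums f (L * t)"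
    unfolding has_egf_def by (rule eventually_compose_filterlim)
  thus ?thesis
    unfolding has_egf_def by (simp add: power_mult_distrib mult_ac)
qed

text \<open>This is the Cauchy product with the exponential series; the factor \<open>fact n\<close>
  turns its coefficients into binomial ones.\<close>

lemma has_egf_mult_exp:
  assumes "has_egf f B"
  shows "has_egf (\<lambda>t. f t * exp (s * t)) (\<lambda>n. \<Sum>i\<le>n. real (n choose i) * s ^ (n - i) * B i)"
proof -
  from assms obtain d where d: "d > 0"
    "\<And>t. t \<noteq> 0 \<Longrightarrow> norm t < d \<Longrightarrow> (\<lambda>n. B n * (t ^ n / fact n)) sums f t"
    unfolding has_egf_def eventually_at by auto
  have "(\<lambda>n. (\<Sum>i\<le>n. real (n choose i) * s ^ (n - i) * B i) * (t ^ n / fact n)) sums (f t * exp (s * t))"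
    if t: "t \<noteq> 0" "norm t < d" for t
  proof -
    \<comment> \<open>Mere convergence at a point strictly between \<open>norm t\<close> and
      \<open>d\<close> gives absolute convergence at \<open>t\<close>, which the Cauchy product
      requires.\<close>
    define r where "r = (norm t + d) / 2"
    have r: "r \<noteq> 0" "norm r < d" "norm t < norm r"
      using t by (auto simp: r_def)
    have "summable (\<lambda>n. B n / fact n * r ^ n)"
      using d(2)[OF r(1,2)] by (simp add: sums_iff mult_ac)
    hence "summable (\<lambda>n. norm (B n / fact n * t ^ n))"
      by (rule powser_insidea) (fact r(3))
    hence B: "summable (\<lambda>n. norm (B n * (t ^ n / fact n)))"
      by (simp add: mult_ac)
    have E: "(\<lambda>n. (s * t) ^ n / fact n) sums exp (s * t)"
      using exp_converges[of "s * t"] by (simp add: divide_inverse mult_ac)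
    have E': "summable (\<lambda>n. norm ((s * t) ^ n / fact n))"
      using summable_norm_exp[of "s * t"] by (simp add: divide_inverse mult_ac)
    have "(\<lambda>n. \<Sum>i\<le>n. (B i * (t ^ i / fact i)) * ((s * t) ^ (n - i) / fact (n - i))) sums
            (f t * exp (s * t))"
      using Cauchy_product_sums[OF B E'] d(2)[OF t] E by (simp add: sums_iff)
    moreover have "(\<Sum>i\<le>n. (B i * (t ^ i / fact i)) * ((s * t) ^ (n - i) / fact (n - i)))
        = (\<Sum>i\<le>n. real (n choose i) * s ^ (n - i) * B i) * (t ^ n / fact n)" for n
      unfolding sum_distrib_right
    proof (rule sum.cong)
      fix i assume "i \<in> {..n}"
      hence i: "i \<le> n" by simp
      have "t ^ n = t ^ i * t ^ (n - i)"
        using i by (simp flip: power_add)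
      thus "(B i * (t ^ i / fact i)) * ((s * t) ^ (n - i) / fact (n - i))
          = real (n choose i) * s ^ (n - i) * B i * (t ^ n / fact n)"
        by (simp add: binomial_fact[OF i] power_mult_distrib)
    qed simp
    ultimately show ?thesis by simp
  qed
  thus ?thesis
    unfolding has_egf_def eventually_at using d(1) by auto
qed

text \<open>The nonzero factor \<open>exp (ln b * t)\<close> cancels. At \<open>t = 0\<close> both
  denominators vanish and both sides are 0, so the equality holds for all \<open>t\<close> and can
  be rewritten under \<open>egf_coeff\<close>.\<close>

lemma gen_poly_bernoulli_poly_generating_function:
  fixes a b c :: real
  assumes "a > 0" "b > 0" "c > 0"
  shows "polylog k (1 - (a * b) powr (- t)) / (b powr t - a powr (- t)) * c powr (x * t)
       = polylog k (1 - exp (- ((ln a + ln b) * t))) / (1 - exp (- ((ln a + ln b) * t)))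
           * exp ((x * ln c - ln b) * t)"
proof -
  let ?L = "ln a + ln b"
  have 1: "(a * b) powr (- t) = exp (- (?L * t))"
    using assms by (simp add: powr_def ln_mult algebra_simps)
  have 2: "b powr t - a powr (- t) = (1 - exp (- (?L * t))) * exp (ln b * t)"
    using assms by (simp add: powr_def algebra_simps flip: exp_add)
  have 3: "c powr (x * t) = exp ((x * ln c - ln b) * t) * exp (ln b * t)"
    using assms by (simp add: powr_def algebra_simps flip: exp_add)
  show ?thesis unfolding 1 2 3 by simp
qed

lemma gen_poly_bernoulli_poly_0:
  assumes "c > 0"
  shows "gen_poly_bernoulli_poly k n 0 a b c = gen_poly_bernoulli k n a b"
  using assms by (simp add: gen_poly_bernoulli_poly_def gen_poly_bernoulli_def)

lemma gen_poly_bernoulli_poly_eq_poly_bernoulli_poly: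
  fixes a b c :: real
  assumes "a > 0" "b > 0" "c > 0" "a * b \<noteq> 1"
  shows "gen_poly_bernoulli_poly k n x a b c
       = (ln a + ln b) ^ n * poly_bernoulli_poly k n ((- ln b + x * ln c) / (ln a + ln b))"
proof -
  let ?L = "ln a + ln b"
  have L: "?L \<noteq> 0"
    using assms by (simp flip: ln_mult_pos)
  \<comment> \<open>The evaluation point is chosen so that rescaling by \<open>?L\<close> produces
    exactly the exponent of the generating function.\<close>
  have "?L * t * ((- ln b + x * ln c) / ?L) = (x * ln c - ln b) * t" for t
    using L by (simp add: field_simps)
  with has_egf_scale[OF has_egf_poly_bernoulli_poly L, of k "(- ln b + x * ln c) / ?L"]
  show ?thesis
    unfolding gen_poly_bernoulli_poly_def
      gen_poly_bernoulli_poly_generating_function[OF assms(1-3)]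
    by (simp add: egf_coeff_eqI)
qed

lemma gen_poly_bernoulli_eq_poly_bernoulli_poly:
  fixes a b :: real
  assumes "a > 0" "b > 0" "a * b \<noteq> 1"
  shows "gen_poly_bernoulli k n a b
       = (ln a + ln b) ^ n * poly_bernoulli_poly k n (- ln b / (ln a + ln b))"
  using gen_poly_bernoulli_poly_eq_poly_bernoulli_poly[of a b 1 k n 0] assms
  by (simp add: gen_poly_bernoulli_poly_0)

lemma gen_poly_bernoulli_eq_sum_poly_bernoulli:
  fixes a b :: real
  assumes "a > 0" "b > 0" "a * b \<noteq> 1"
  shows "gen_poly_bernoulli k n a b
       = (\<Sum>i=0..n. (-1) ^ (n - i) * real (n choose i) * (ln a + ln b) ^ i
            * (ln b) ^ (n - i) * poly_bernoulli k i)"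
proof -
  let ?L = "ln a + ln b"
  have L: "?L \<noteq> 0"
    using assms by (simp flip: ln_mult_pos)
  have "gen_poly_bernoulli k n a b = gen_poly_bernoulli_poly k n 0 a b 1"
    by (simp add: gen_poly_bernoulli_poly_0)
  \<comment> \<open>For \<open>x = 0\<close> the exponential factor is
    \<open>exp (- ln b * t)\<close>, multiplied onto the rescaled series of the classical
    numbers.\<close>
  also have "\<dots> = (\<Sum>i\<le>n. real (n choose i) * (- ln b) ^ (n - i) * (?L ^ i * poly_bernoulli k i))"
    using has_egf_mult_exp[OF has_egf_scale[OF has_egf_poly_bernoulli[of k] L], of "- ln b"]
    unfolding gen_poly_bernoulli_poly_def
      gen_poly_bernoulli_poly_generating_function[OF assms(1,2) zero_less_one]
    by (simp add: egf_coeff_eqI)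
  also have "\<dots> = (\<Sum>i=0..n. (-1) ^ (n - i) * real (n choose i) * ?L ^ i
            * (ln b) ^ (n - i) * poly_bernoulli k i)"
    unfolding atMost_atLeast0 by (intro sum.cong refl, subst power_minus) (simp add: mult_ac)
  finally show ?thesis .
qed

lemma gen_poly_bernoulli_poly_eq_sum_gen_poly_bernoulli:
  fixes a b c :: real
  assumes "a > 0" "b > 0" "c > 0" "a * b \<noteq> 1"
  shows "gen_poly_bernoulli_poly k n x a b c
       = (\<Sum>l=0..n. real (n choose l) * (ln c) ^ (n - l)
            * gen_poly_bernoulli k l a b * x ^ (n - l))"
proof -
  have "c powr (x * t) = exp (x * ln c * t)" for t
    using assms by (simp add: powr_def mult_ac)
  hence "gen_poly_bernoulli_poly k n x a b c
      = (\<Sum>l\<le>n. real (n choose l) * (x * ln c) ^ (n - l) * gen_poly_bernoulli k l a b)"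
    using has_egf_mult_exp[OF has_egf_gen_poly_bernoulli[OF assms(1,2,4), of k], of "x * ln c"]
    unfolding gen_poly_bernoulli_poly_def by (simp add: egf_coeff_eqI)
  thus ?thesis
    by (simp add: atMost_atLeast0 power_mult_distrib mult_ac)
qed

text \<open>The generating function depends on the parameters only through
  \<open>ln a + ln b\<close> and \<open>x * ln c - ln b\<close>, and both quantities agree on the
  two sides.\<close>

lemma gen_poly_bernoulli_poly_add_1:
  fixes a b c :: real
  assumes "a > 0" "b > 0" "c > 0"
  shows "gen_poly_bernoulli_poly k n (x + 1) a b c
       = gen_poly_bernoulli_poly k n x (a * c) (b / c) c"
proof -
  have ac: "a * c > 0" "b / c > 0" using assms by simp_all
  have "ln (a * c) + ln (b / c) = ln a + ln b" "x * ln c - ln (b / c) = (x + 1) * ln c - ln b"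
    using assms by (simp_all add: ln_mult ln_div algebra_simps)
  thus ?thesis
    unfolding gen_poly_bernoulli_poly_def
      gen_poly_bernoulli_poly_generating_function[OF assms]
      gen_poly_bernoulli_poly_generating_function[OF ac assms(3)]
    by simp
qed

text \<open>The two bases have product \<open>exp 1\<close>, so their logarithms sum to 1: the scale
  factor disappears and the evaluation point is \<open>t\<close>.\<close>

lemma poly_bernoulli_poly_eq_gen_poly_bernoulli:
  "poly_bernoulli_poly k n t = gen_poly_bernoulli k n (exp (t + 1)) (exp (- t))"
  by (subst gen_poly_bernoulli_eq_poly_bernoulli_poly) (simp_all flip: exp_add)

theorem theorem1:
  fixes k :: int and n :: nat and x a b c :: real
  assumes "a > 0" and "b > 0" and "c > 0"
    and "a \<noteq> b" and "b > a" and "a * b \<noteq> 1"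
  shows "gen_poly_bernoulli k n a b
           = (ln a + ln b) ^ n * poly_bernoulli_poly k n (- ln b / (ln a + ln b))
       \<and> gen_poly_bernoulli k n a b
           = (\<Sum>i=0..n. (-1) ^ (n - i) * real (n choose i) * (ln a + ln b) ^ i
                * (ln b) ^ (n - i) * poly_bernoulli k i)
       \<and> gen_poly_bernoulli_poly k n x a b c
           = (\<Sum>l=0..n. real (n choose l) * (ln c) ^ (n - l)
                * gen_poly_bernoulli k l a b * x ^ (n - l))
       \<and> gen_poly_bernoulli_poly k n (x + 1) a b c
           = gen_poly_bernoulli_poly k n x (a * c) (b / c) c
       \<and> (\<forall>t::real. poly_bernoulli_poly k n t
             = gen_poly_bernoulli k n (exp (t + 1)) (exp (- t)))
       \<and> gen_poly_bernoulli_poly k n x a b c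
           = (ln a + ln b) ^ n * poly_bernoulli_poly k n ((- ln b + x * ln c) / (ln a + ln b))"
  by (intro conjI allI gen_poly_bernoulli_eq_poly_bernoulli_poly
      gen_poly_bernoulli_eq_sum_poly_bernoulli gen_poly_bernoulli_poly_eq_sum_gen_poly_bernoulli
      gen_poly_bernoulli_poly_add_1 poly_bernoulli_poly_eq_gen_poly_bernoulli
      gen_poly_bernoulli_poly_eq_poly_bernoulli_poly assms)

end
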